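(* Let $(x,y)\in\mathbb{Z}_{\geq0}^2$ with $x\ge 8$ or $y\ge 8$. Then the Grundy number of $(x,y)$ in the variant of Wythoff's game with terminal set $T=\{(x,y):x+y\le 2\}$ equals $1$ if and only if $(x,y)$ is a $\mathcal{P}$-position of Wythoff's game, i.e. if and only if $(x,y)\in\{(\lfloor n\phi\rfloor,\lfloor n(\phi+1)\rfloor):n\ge0\}\cup\{(\lfloor n(\phi+1)\rfloor,\lfloor n\phi\rfloor):n\ge0\}$, where $\phi=\frac{1+\sqrt5}{2}$.
   Context: Moves: from $(x,y)\in\mathbb{Z}_{\geq0}^2$ one may move to any $(u,y)$ with $0\le u<x$, any $(x,v)$ with $0\le v<y$, or any $(x-t,y-t)$ with $1\le t\le\min(x,y)$. In the variant, positions in $T=\{(x,y):x+y\le2\}$ are terminal (have no moves), and the player moving into $T$ wins. The Grundy number of a position $p$ is $G(p)=\mathrm{mex}\{G(q): q \text{ reachable from } p \text{ in one move}\}$, where $\mathrm{mex}$ of a set of nonnegative integers is the least nonnegative integer not in it (so terminal positions have Grundy number $0$). A $\mathcal{P}$-position of Wythoff's game (queen moves, player moving to $(0,0)$ wins) is one from which the previous player wins with correct play. *)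

theory Defs
  imports Complex_Main
begin

definition queen_moves :: "nat \<times> nat \<Rightarrow> (nat \<times> nat) set" where
  "queen_moves p = (case p of (x, y) \<Rightarrow>
     {(u, y) |u. u < x} \<union> {(x, v) |v. v < y} \<union>
     {(x - t, y - t) |t. 1 \<le> t \<and> t \<le> min x y})"

definition options :: "(nat \<times> nat) set \<Rightarrow> nat \<times> nat \<Rightarrow> (nat \<times> nat) set" where
  "options T p = (if p \<in> T then {} else queen_moves p)"

lemma options_decreasing: "q \<in> options T p \<Longrightarrow> fst q + snd q < fst p + snd p"
  by (auto simp: options_def queen_moves_def split: if_splits prod.splits)

definition mex :: "nat set \<Rightarrow> nat" where
  "mex A = (LEAST n. n \<notin> A)"

function grundy :: "(nat \<times> nat) set \<Rightarrow> nat \<times> nat \<Rightarrow> nat" where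
  "grundy T p = mex (grundy T ` options T p)"
  by pat_completeness auto
termination
  by (relation "measure (\<lambda>(T, p). fst p + snd p)") (auto dest: options_decreasing)

declare grundy.simps [simp del]

text \<open>
  Outcomes under normal play on the queen moves with terminal set \<open>T\<close>. A player without
  a move has lost, as the opponent has just moved into a terminal position.
\<close>

inductive prev_wins :: "(nat \<times> nat) set \<Rightarrow> nat \<times> nat \<Rightarrow> bool"
  and next_wins :: "(nat \<times> nat) set \<Rightarrow> nat \<times> nat \<Rightarrow> bool"
  for T :: "(nat \<times> nat) set" where
  "(\<And>q. q \<in> options T p \<Longrightarrow> next_wins T q) \<Longrightarrow> prev_wins T p"
| "q \<in> options T p \<Longrightarrow> prev_wins T q \<Longrightarrow> next_wins T p"

definition wythoff_P_position :: "nat \<times> nat \<Rightarrow> bool" where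
  "wythoff_P_position p \<longleftrightarrow> prev_wins {(0, 0)} p"

definition variant_terminals :: "(nat \<times> nat) set" where
  "variant_terminals = {(x, y). x + y \<le> 2}"

definition golden_ratio :: real where
  "golden_ratio = (1 + sqrt 5) / 2"

end

theory Submission
  imports Defs
begin

text \<open>
  For \<open>s \<ge> 1\<close>, the game with terminal set \<open>x + y < s\<close> has as its other \<open>\<P>\<close>-positions the
  pairs \<open>(w n, w n + n)\<close>, \<open>n \<ge> s\<close>, and their mirror images, where \<open>w n\<close> is the least number that
  is at least \<open>s\<close> and is no coordinate of an earlier pair. Counting the numbers below \<open>w n\<close> gives
  \<open>w n = n + card {k < n. w k + k < w n}\<close>; by induction, \<open>w n\<close> stays within a constant of
  \<open>n \<phi>\<close>. For \<open>s = 1\<close> this is Wythoff's game and \<open>w n = \<lfloor>n \<phi>\<rfloor>\<close>; for \<open>s = 3\<close> it is the variant,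
  whose sequence is strictly below the one of Wythoff's game.

  The positions of Grundy number 1 in the variant are the Wythoff pairs, with those of difference
  0, 1, 2, 3 replaced by (4,4), (1,2), (5,7), (0,3). The two quadruples of pairs occupy the same
  coordinates and the same differences, so the replaced set is still independent and every
  nonterminal position outside it has a move into it. Each Wythoff pair \<open>(w n, w n + n)\<close> with
  \<open>n \<ge> 4\<close> has an option of Grundy number 0, namely the variant pair on the same diagonal.
\<close>

section \<open>Grundy numbers 0 and 1\<close>

lemma mex_notin: "finite A \<Longrightarrow> mex A \<notin> A"
  unfolding mex_def by (rule LeastI_ex) (rule ex_new_if_finite[OF infinite_UNIV_nat])

lemma mem_if_less_mex: "k < mex A \<Longrightarrow> k \<in> A"
  unfolding mex_def using not_less_Least by blast

lemma mex_le: "k \<notin> A \<Longrightarrow> mex A \<le> k"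
  unfolding mex_def by (rule Least_le)

lemma mex_eq_0_iff: "finite A \<Longrightarrow> mex A = 0 \<longleftrightarrow> 0 \<notin> A"
  using mex_notin[of A] mex_le[of 0 A] by auto

lemma mex_eq_1_iff: "finite A \<Longrightarrow> mex A = 1 \<longleftrightarrow> 0 \<in> A \<and> 1 \<notin> A"
  using mex_notin[of A] mex_le[of 0 A] mex_le[of 1 A] mem_if_less_mex[of 0 A]
  by (metis le_zero_eq less_one linorder_neqE_nat not_less zero_neq_one)

lemma options_finite: "finite (options T p)"
proof (rule finite_subset)
  show "options T p \<subseteq> {..fst p} \<times> {..snd p}"
    by (auto simp: options_def queen_moves_def split: prod.splits)
qed simp

lemma grundy_eq_0_iff: "grundy T p = 0 \<longleftrightarrow> (\<forall>q \<in> options T p. grundy T q \<noteq> 0)"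
  by (subst grundy.simps, subst mex_eq_0_iff) (auto simp: options_finite image_iff)

lemma grundy_eq_1_iff:
  "grundy T p = 1 \<longleftrightarrow> (\<exists>q \<in> options T p. grundy T q = 0) \<and> (\<forall>q \<in> options T p. grundy T q \<noteq> 1)"
  by (subst grundy.simps, subst mex_eq_1_iff) (auto simp: options_finite image_iff)

lemma position_induct [case_names step]:
  assumes "\<And>p. (\<And>q. q \<in> options T p \<Longrightarrow> P q) \<Longrightarrow> P p"
  shows "P p"
proof (induction p rule: measure_induct_rule[of "\<lambda>p. fst p + snd p"])
  case (less p)
  then show ?case using assms options_decreasing by blast
qed

text \<open>Induction along moves: an independent and absorbing set, a kernel of the game graph, is
  unique, and the zeros of the Grundy function form one. Terminal positions lie in \<open>Z\<close>
  by the second premise.\<close>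

lemma grundy_eq_0_iff_mem:
  assumes "\<And>p q. p \<in> Z \<Longrightarrow> q \<in> options T p \<Longrightarrow> q \<notin> Z"
    and "\<And>p. p \<notin> Z \<Longrightarrow> \<exists>q \<in> options T p. q \<in> Z"
  shows "grundy T p = 0 \<longleftrightarrow> p \<in> Z"
proof (induction p rule: position_induct[where T = T])
  case (step p)
  then show ?case using assms by (subst grundy_eq_0_iff) blast
qed

text \<open>The second premise keeps \<open>S\<close> outside \<open>T\<close>; the third exempts
  \<open>T\<close>, whose positions have value 0 and no move. Any other position outside
  \<open>S\<close> has an option in \<open>S\<close>, of value 1 by induction.\<close>

lemma grundy_eq_1_iff_mem:
  assumes "\<And>p q. p \<in> S \<Longrightarrow> q \<in> options T p \<Longrightarrow> q \<notin> S"
    and "\<And>p. p \<in> S \<Longrightarrow> \<exists>q \<in> options T p. grundy T q = 0"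
    and "\<And>p. p \<notin> S \<Longrightarrow> p \<notin> T \<Longrightarrow> \<exists>q \<in> options T p. q \<in> S"
  shows "grundy T p = 1 \<longleftrightarrow> p \<in> S"
proof (induction p rule: position_induct[where T = T])
  case (step p)
  have "p \<notin> S" "options T p = {}" if "p \<in> T"
    using assms(2)[of p] that by (auto simp: options_def)
  then show ?case using assms step by (subst grundy_eq_1_iff) blast
qed

lemma outcome_grundy:
  "(prev_wins T p \<longleftrightarrow> grundy T p = 0) \<and> (next_wins T p \<longleftrightarrow> grundy T p \<noteq> 0)"
proof (induction p rule: position_induct[where T = T])
  case (step p)
  then show ?case
    using grundy_eq_0_iff[of T p] prev_wins.simps[of T p] next_wins.simps[of T p] by metis
qed

section \<open>Sets of pairs with prescribed differences\<close>

text \<open>The index is the difference of the coordinates and \<open>c n\<close> the smaller one,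
  so a diagonal move can join only pairs of equal index.\<close>

definition pairs :: "(nat \<Rightarrow> nat) \<Rightarrow> nat set \<Rightarrow> (nat \<times> nat) set" where
  "pairs c I = {(c n, c n + n) |n. n \<in> I} \<union> {(c n + n, c n) |n. n \<in> I}"

lemma pairs_memI:
  "n \<in> I \<Longrightarrow> (c n, c n + n) \<in> pairs c I" "n \<in> I \<Longrightarrow> (c n + n, c n) \<in> pairs c I"
  by (auto simp: pairs_def)

lemma pairs_cong: "(\<And>n. n \<in> I \<Longrightarrow> c n = d n) \<Longrightarrow> pairs c I = pairs d I"
  unfolding pairs_def by (intro arg_cong2[where f = "(\<union>)"] Collect_cong) metis+

lemma swap_mem_pairs_iff: "(y, x) \<in> pairs c I \<longleftrightarrow> (x, y) \<in> pairs c I"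
  by (auto simp: pairs_def)

lemma swap_mem_queen_moves_iff: "(v, u) \<in> queen_moves (y, x) \<longleftrightarrow> (u, v) \<in> queen_moves (x, y)"
  by (auto simp: queen_moves_def min.commute)

lemma queen_moves_iff:
  "(u, v) \<in> queen_moves (x, y) \<longleftrightarrow>
    u < x \<and> v = y \<or> u = x \<and> v < y \<or> u < x \<and> v < y \<and> x + v = y + u"
proof -
  have "\<exists>t. u = x - t \<and> v = y - t \<and> 1 \<le> t \<and> t \<le> min x y"
    if "u < x \<and> v < y \<and> x + v = y + u"
    using that by (intro exI[of _ "x - u"]) auto
  then show ?thesis by (auto simp: queen_moves_def)
qed

text \<open>A queen move preserves a coordinate or the difference. A shared coordinate forces equal
  indices by one of the first three assumptions, a shared difference does so directly; and no pair
  has a move to itself or to its mirror image.\<close>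

lemma pairs_independent:
  assumes c: "inj_on c I" and d: "inj_on (\<lambda>n. c n + n) I"
    and cd: "\<And>i j. i \<in> I \<Longrightarrow> j \<in> I \<Longrightarrow> c i = c j + j \<Longrightarrow> i = j"
    and "p \<in> pairs c I" and "q \<in> queen_moves p"
  shows "q \<notin> pairs c I"
proof
  assume "q \<in> pairs c I"
  obtain x y u v where pq: "p = (x, y)" "q = (u, v)" by fastforce
  from \<open>p \<in> pairs c I\<close> obtain i where i: "i \<in> I" "x = c i \<and> y = c i + i \<or> x = c i + i \<and> y = c i"
    unfolding pq pairs_def by blast
  from \<open>q \<in> pairs c I\<close> obtain j where j: "j \<in> I" "u = c j \<and> v = c j + j \<or> u = c j + j \<and> v = c j"
    unfolding pq pairs_def by blast
  have "i = j"
    using assms(5) i j inj_onD[OF c _ i(1) j(1)] inj_onD[OF d _ i(1) j(1)] cd[OF i(1) j(1)]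
      cd[OF j(1) i(1)]
    unfolding pq queen_moves_iff by auto
  then show False using assms(5) i j unfolding pq queen_moves_iff by auto
qed

section \<open>Generalised Wythoff sequences\<close>

text \<open>Indices start at \<open>s\<close> because the corner contains positions of every
  difference below \<open>s\<close>. For \<open>n \<le> s\<close> the recursion sees only
  \<open>{..<s}\<close> and returns \<open>s\<close>.\<close>

function wythoff_seq :: "nat \<Rightarrow> nat \<Rightarrow> nat" where
  "wythoff_seq s n =
    mex ({..<s} \<union> wythoff_seq s ` {s..<n} \<union> (\<lambda>k. wythoff_seq s k + k) ` {s..<n})"
  by pat_completeness auto
termination
  by (relation "measure snd") auto

declare wythoff_seq.simps [simp del]

lemma wythoff_seq_notin:
  "wythoff_seq s n \<notin> {..<s} \<union> wythoff_seq s ` {s..<n} \<union> (\<lambda>k. wythoff_seq s k + k) ` {s..<n}"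
  by (subst wythoff_seq.simps, rule mex_notin) simp

lemma mem_if_less_wythoff_seq:
  "x < wythoff_seq s n \<Longrightarrow>
    x \<in> {..<s} \<union> wythoff_seq s ` {s..<n} \<union> (\<lambda>k. wythoff_seq s k + k) ` {s..<n}"
  by (subst (asm) wythoff_seq.simps) (rule mem_if_less_mex)

lemma wythoff_seq_ge: "s \<le> wythoff_seq s n"
  using wythoff_seq_notin[of s n] by auto

text \<open>\<open>wythoff_seq s n\<close> avoids the set whose mex is
  \<open>wythoff_seq s k\<close>, which gives \<le>; it also avoids \<open>wythoff_seq s k\<close>
  itself.\<close>

lemma wythoff_seq_less:
  assumes "s \<le> k" "k < n"
  shows "wythoff_seq s k < wythoff_seq s n"
proof -
  have "wythoff_seq s n \<notin> {..<s} \<union> wythoff_seq s ` {s..<k} \<union> (\<lambda>k. wythoff_seq s k + k) ` {s..<k}"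
    using wythoff_seq_notin[of s n] assms by auto
  then have "wythoff_seq s k \<le> wythoff_seq s n"
    by (subst (1) wythoff_seq.simps) (rule mex_le)
  moreover have "wythoff_seq s k \<in> wythoff_seq s ` {s..<n}" using assms by simp
  then have "wythoff_seq s k \<noteq> wythoff_seq s n"
    using wythoff_seq_notin[of s n] by auto
  ultimately show ?thesis by simp
qed

lemma inj_on_wythoff_seq: "inj_on (wythoff_seq s) {s..}"
  by (rule linorder_inj_onI') (use wythoff_seq_less in fastforce)

lemma inj_on_wythoff_seq_add: "inj_on (\<lambda>n. wythoff_seq s n + n) {s..}"
  by (rule linorder_inj_onI') (use wythoff_seq_less in fastforce)

lemma wythoff_seq_neq_add:
  assumes "1 \<le> s" "s \<le> i" "s \<le> j"
  shows "wythoff_seq s i \<noteq> wythoff_seq s j + j"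
proof (cases "j < i")
  case True
  then show ?thesis using wythoff_seq_notin[of s i] assms by auto
next
  case False
  then have "wythoff_seq s i \<le> wythoff_seq s j"
    using wythoff_seq_less[of s i j] assms by (cases "i = j") auto
  then show ?thesis using assms by simp
qed

lemma wythoff_seq_ge_index: "s \<le> n \<Longrightarrow> n \<le> wythoff_seq s n"
proof (induction n rule: dec_induct)
  case base
  show ?case by (rule wythoff_seq_ge)
next
  case (step n)
  then show ?case using wythoff_seq_less[of s n "Suc n"] by simp
qed

lemma wythoff_seq_cover:
  assumes "s \<le> x"
  obtains n where "s \<le> n" "x = wythoff_seq s n" | n where "s \<le> n" "x = wythoff_seq s n + n"
proof -
  \<comment> \<open>An index beyond \<open>x\<close> has a value beyond \<open>x\<close>, so
    \<open>x\<close> is in the set whose mex is taken there.\<close>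
  have "x < wythoff_seq s (Suc x)"
    using wythoff_seq_ge_index[of s "Suc x"] assms by simp
  from mem_if_less_wythoff_seq[OF this] show ?thesis
    using assms that by auto
qed

section \<open>Grundy number 0 with a triangular terminal set\<close>

definition corner :: "nat \<Rightarrow> (nat \<times> nat) set" where
  "corner s = {(x, y). x + y < s}"

lemma grundy_corner_eq_0_iff:
  assumes s: "1 \<le> s"
  shows "grundy (corner s) p = 0 \<longleftrightarrow> p \<in> corner s \<union> pairs (wythoff_seq s) {s..}"
proof (rule grundy_eq_0_iff_mem)
  let ?w = "wythoff_seq s"
  let ?Z = "corner s \<union> pairs ?w {s..}"
  fix p q assume p: "p \<in> ?Z" and q: "q \<in> options (corner s) p"
  from q have nT: "p \<notin> corner s" and q: "q \<in> queen_moves p"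
    by (auto simp: options_def split: if_splits)
  with p have pw: "p \<in> pairs ?w {s..}" by simp
  have "q \<notin> pairs ?w {s..}"
    using inj_on_wythoff_seq inj_on_wythoff_seq_add _ pw q
    by (rule pairs_independent) (use wythoff_seq_neq_add[OF s] in auto)
  \<comment> \<open>A straight move leaves one coordinate, at least \<open>s\<close>, in place; a
    diagonal move keeps the difference \<open>n \<ge> s\<close>. Either way the sum stays at least
    \<open>s\<close>.\<close>
  moreover have "q \<notin> corner s"
  proof -
    obtain x y u v where pq: "p = (x, y)" "q = (u, v)" by fastforce
    from pw obtain n where "s \<le> n" "x = ?w n \<and> y = ?w n + n \<or> x = ?w n + n \<and> y = ?w n"
      unfolding pq pairs_def by auto
    then show ?thesis using q wythoff_seq_ge[of s n] by (auto simp: pq queen_moves_iff corner_def)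
  qed
  ultimately show "q \<notin> ?Z" by simp
next
  let ?w = "wythoff_seq s"
  let ?Z = "corner s \<union> pairs ?w {s..}"
  have *: "\<exists>u v. (u, v) \<in> queen_moves (x, y) \<and> (u, v) \<in> ?Z" if "x \<le> y" and nZ: "(x, y) \<notin> ?Z" for x y
  proof (cases "x < s")
    case True
    then have "(x, 0) \<in> queen_moves (x, y) \<and> (x, 0) \<in> ?Z"
      using that by (auto simp: queen_moves_iff corner_def)
    then show ?thesis by blast
  next
    case False
    then have "s \<le> x" by simp
    then show ?thesis
    proof (cases rule: wythoff_seq_cover)
      case (1 n)
      have "y \<noteq> x + n" using nZ 1 by (auto simp: pairs_def)
      then consider "x + n < y" | "y < x + n" "y - x < s" | "y < x + n" "s \<le> y - x"
        by linarith
      then show ?thesis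
      proof cases
        case 1
        then have "(x, x + n) \<in> queen_moves (x, y) \<and> (x, x + n) \<in> ?Z"
          using \<open>s \<le> n\<close> \<open>x = ?w n\<close> by (auto simp: queen_moves_iff pairs_def)
        then show ?thesis by blast
      next
        case 2
        \<comment> \<open>A diagonal of difference below \<open>s\<close> runs into the
          corner.\<close>
        then have "(0, y - x) \<in> queen_moves (x, y) \<and> (0, y - x) \<in> ?Z"
          using \<open>s \<le> x\<close> \<open>x \<le> y\<close> s by (auto simp: queen_moves_iff corner_def)
        then show ?thesis by blast
      next
        case 3
        let ?d = "y - x"
        \<comment> \<open>Since \<open>y - x < n\<close>, the pair on this diagonal starts strictly
          below \<open>x = ?w n\<close>.\<close>
        have "?w ?d < x" using 3 \<open>x = ?w n\<close> \<open>x \<le> y\<close> wythoff_seq_less[of s ?d n] by simp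
        then have "(?w ?d, ?w ?d + ?d) \<in> queen_moves (x, y)"
          using \<open>x \<le> y\<close> by (auto simp: queen_moves_iff)
        moreover have "(?w ?d, ?w ?d + ?d) \<in> ?Z" using 3 pairs_memI(1)[of ?d] by auto
        ultimately show ?thesis by blast
      qed
    next
      case (2 n)
      then have "(x, ?w n) \<in> queen_moves (x, y)" 
        using \<open>x \<le> y\<close> s by (auto simp: queen_moves_iff)
      moreover have "(x, ?w n) \<in> ?Z" using 2 pairs_memI(2)[of n] by auto
      ultimately show ?thesis by blast
    qed
  qed
  fix p assume p: "p \<notin> ?Z"
  obtain x y where xy: "p = (x, y)" by fastforce
  have "\<exists>u v. (u, v) \<in> queen_moves (x, y) \<and> (u, v) \<in> ?Z"
  proof (cases "x \<le> y")
    case True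
    then show ?thesis using * p xy by simp
  next
    case False
    have sw: "(a, b) \<in> ?Z \<longleftrightarrow> (b, a) \<in> ?Z" for a b
      by (auto simp: swap_mem_pairs_iff corner_def)
    show ?thesis
      using *[of y x] p xy False sw swap_mem_queen_moves_iff by (metis nat_le_linear)
  qed
  then show "\<exists>q \<in> options (corner s) p. q \<in> ?Z"
    using p xy by (auto simp: options_def)
qed

section \<open>Counting recursion and linear bounds\<close>

text \<open>The numbers below the term at \<open>n\<close> form three disjoint sets: the
  \<open>s\<close> numbers below \<open>s\<close>, the \<open>n - s\<close> earlier terms, and the
  larger coordinates counted by the cardinality.\<close>

lemma wythoff_seq_eq_card:
  assumes s: "1 \<le> s" "s \<le> n"
  shows "wythoff_seq s n = n + card {k \<in> {s..<n}. wythoff_seq s k + k < wythoff_seq s n}"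
proof -
  let ?w = "wythoff_seq s"
  let ?B = "{k \<in> {s..<n}. ?w k + k < ?w n}"
  have 1: "{..<?w n} = ({..<s} \<union> ?w ` {s..<n}) \<union> (\<lambda>k. ?w k + k) ` ?B"
  proof (intro equalityI subsetI)
    fix x assume "x \<in> {..<?w n}"
    then show "x \<in> ({..<s} \<union> ?w ` {s..<n}) \<union> (\<lambda>k. ?w k + k) ` ?B"
      using mem_if_less_wythoff_seq[of x s n] by auto
  next
    fix x assume "x \<in> ({..<s} \<union> ?w ` {s..<n}) \<union> (\<lambda>k. ?w k + k) ` ?B"
    then show "x \<in> {..<?w n}"
      using wythoff_seq_less[of s _ n] wythoff_seq_ge[of s n] by auto
  qed
  have "card {..<?w n} = card ({..<s} \<union> ?w ` {s..<n}) + card ((\<lambda>k. ?w k + k) ` ?B)"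
    unfolding 1
  proof (rule card_Un_disjoint)
    show "({..<s} \<union> ?w ` {s..<n}) \<inter> (\<lambda>k. ?w k + k) ` ?B = {}"
    proof (rule ccontr)
      assume "\<not> ?thesis"
      then obtain k where k: "s \<le> k" "?w k + k \<in> {..<s} \<union> ?w ` {s..<n}" by auto
      moreover have "?w k + k \<notin> {..<s}" using wythoff_seq_ge[of s k] by simp
      ultimately obtain j where "s \<le> j" "?w k + k = ?w j" by auto
      then show False using wythoff_seq_neq_add[OF s(1), of j k] k(1) by simp
    qed
  qed auto
  also have "card ({..<s} \<union> ?w ` {s..<n}) = s + card (?w ` {s..<n})"
    by (subst card_Un_disjoint) (use wythoff_seq_ge[of s] in \<open>auto simp: not_less[symmetric]\<close>)
  also have "card (?w ` {s..<n}) = n - s"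
    by (subst card_image) (auto intro: inj_on_subset[OF inj_on_wythoff_seq])
  also have "card ((\<lambda>k. ?w k + k) ` ?B) = card ?B"
    by (rule card_image) (auto intro: inj_on_subset[OF inj_on_wythoff_seq_add])
  finally show ?thesis using s by simp
qed

text \<open>Tight enough to single out the first four terms for \<open>s = 1\<close>; the third one,
  4, requires 3 \<phi> < 5.\<close>

lemma golden_ratio_bounds: "1.6 < golden_ratio" "golden_ratio < 1.65"
proof -
  have "2.2 < sqrt 5" by (rule real_less_rsqrt) (simp add: power2_eq_square)
  moreover have "sqrt 5 < 2.25" by (rule real_less_lsqrt) (simp_all add: power2_eq_square)
  ultimately show "1.6 < golden_ratio" "golden_ratio < 1.65"
    by (simp_all add: golden_ratio_def)
qed

lemma golden_ratio_square: "golden_ratio * golden_ratio = golden_ratio + 1"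
  by (simp add: golden_ratio_def field_simps)

text \<open>
  The side condition makes the bound on the cardinality in the upper estimate valid when the
  counted set is empty.
\<close>

lemma wythoff_seq_bounds:
  fixes \<epsilon> :: real
  assumes s: "1 \<le> s" "s \<le> n" and e: "0 \<le> \<epsilon>"
    and side: "(real s - 1) * (golden_ratio + 1) < 2 * real s - 1 + \<epsilon>"
  shows "real n * golden_ratio - real s - \<epsilon> < real (wythoff_seq s n) \<and>
    real (wythoff_seq s n) < real n * golden_ratio - real s + 1 + \<epsilon>"
  using s(2)
proof (induction n rule: less_induct)
  case (less n)
  define \<phi> where "\<phi> = golden_ratio"
  have \<phi>: "1 < \<phi>" "\<phi> < 2" "\<phi> * \<phi> = \<phi> + 1"
    using golden_ratio_bounds golden_ratio_square by (simp_all add: \<phi>_def)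
  define m where "m = wythoff_seq s n"
  define B where "B = {k \<in> {s..<n}. wythoff_seq s k + k < m}"
  have IH: "real k * (\<phi> + 1) - s - \<epsilon> < real (wythoff_seq s k + k)"
      "real (wythoff_seq s k + k) < real k * (\<phi> + 1) - s + 1 + \<epsilon>" if "k \<in> {s..<n}" for k
    using less.IH[of k] that by (auto simp: \<phi>_def algebra_simps)
  have finB: "finite B" by (simp add: B_def)
  have m: "real m = real n + real (card B)"
    using wythoff_seq_eq_card[OF s(1) less.prems] unfolding m_def B_def by simp
  have "(real (card B) + real s - 1) * (\<phi> + 1) < real m - 1 + real s + \<epsilon>"
  proof (cases "B = {}")
    case True
    then show ?thesis using side wythoff_seq_ge[of s n] by (simp add: \<phi>_def m_def)
  next
    case False
    \<comment> \<open>The largest counted index is at least \<open>card B + s - 1\<close>, so the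
      lower bound at \<open>K\<close> from the induction hypothesis caps
      \<open>card B\<close>.\<close>
    define K where "K = Max B"
    have K: "K \<in> B" using Max_in[OF finB False] by (simp add: K_def)
    have "B \<subseteq> {s..K}" using Max_ge[OF finB] by (auto simp: K_def B_def)
    then have "card B \<le> Suc K - s" using card_mono[of "{s..K}" B] by simp
    then have "real (card B) + real s - 1 \<le> real K" using K by (auto simp: B_def)
    then have "(real (card B) + real s - 1) * (\<phi> + 1) \<le> real K * (\<phi> + 1)"
      using \<phi> by (intro mult_right_mono) auto
    also have "\<dots> < real (wythoff_seq s K + K) + s + \<epsilon>"
      using IH(1)[of K] K by (simp add: B_def)
    also have "\<dots> \<le> real m - 1 + real s + \<epsilon>"
      using K by (auto simp: B_def)
    finally show ?thesis .
  qed
  then have "(real m - real n + real s - 1) * (\<phi> + 1) < real m - 1 + real s + \<epsilon>"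
    using m by simp
  then have "real m * \<phi> < real n * (\<phi> + 1) - (real s - 1) * \<phi> + \<epsilon>"
    by (simp add: algebra_simps)
  \<comment> \<open>Division by \<phi>, with \<phi> * \<phi> = \<phi> + 1, turns n (\<phi> + 1) into
    n \<phi> and can only shrink \<epsilon>, so the error term survives the recursion
    unchanged.\<close>
  also have "\<dots> \<le> (real n * \<phi> - real s + 1 + \<epsilon>) * \<phi>"
  proof -
    have "\<epsilon> * 1 \<le> \<epsilon> * \<phi>" using \<phi> e by (intro mult_left_mono) auto
    moreover have "(real n * \<phi> - real s + 1 + \<epsilon>) * \<phi> = real n * (\<phi> * \<phi>) - (real s - 1) * \<phi> + \<epsilon> * \<phi>"
      by (simp add: algebra_simps)
    ultimately show ?thesis using \<phi>(3) by simp
  qed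
  finally have upper: "real m < real n * \<phi> - real s + 1 + \<epsilon>"
    using \<phi> by simp
  have lower: "real n * \<phi> - real s - \<epsilon> < real m"
  proof (cases "card B + s < n")
    case False
    \<comment> \<open>Here \<open>card B \<ge> n - s\<close>, and \<phi> < 2 suffices.\<close>
    then have "2 * real n - real s \<le> real m" using m by linarith
    moreover have "real n * \<phi> < real n * 2" using \<phi> s less.prems by simp
    ultimately show ?thesis using e by simp
  next
    case True
    define K where "K = card B + s"
    \<comment> \<open>Otherwise the upper bound of the induction hypothesis puts all of
      \<open>{s..K}\<close> into \<open>B\<close>, but these are \<open>card B + 1\<close>
      indices.\<close>
    have "real m + real s - \<epsilon> < real K * (\<phi> + 1)"
    proof (rule ccontr)
      assume neg: "\<not> ?thesis"
      have "k \<in> B" if "k \<in> {s..K}" for k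
      proof -
        have k: "k \<in> {s..<n}" using that True by (auto simp: K_def)
        have "real k * (\<phi> + 1) \<le> real K * (\<phi> + 1)"
          using that \<phi> by (intro mult_right_mono) auto
        then have "real (wythoff_seq s k + k) < real m + 1"
          using IH(2)[OF k] neg by linarith
        then have "wythoff_seq s k + k \<le> m" by linarith
        \<comment> \<open>Rounding gives only \<le>; equality is excluded because smaller and larger
          coordinates never coincide.\<close>
        moreover have "m \<noteq> wythoff_seq s k + k"
          using wythoff_seq_neq_add[OF s(1) less.prems, of k] k by (simp add: m_def)
        ultimately show ?thesis using k by (simp add: B_def)
      qed
      then have "card {s..K} \<le> card B" by (intro card_mono finB) auto
      then show False by (simp add: K_def)
    qed
    then have "real m + real s - \<epsilon> < (real m - real n + real s) * (\<phi> + 1)"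
      using m by (simp add: K_def)
    then have "real n * (\<phi> + 1) - real s * \<phi> - \<epsilon> < real m * \<phi>"
      by (simp add: algebra_simps)
    moreover have "(real n * \<phi> - real s - \<epsilon>) * \<phi> \<le> real n * (\<phi> + 1) - real s * \<phi> - \<epsilon>"
    proof -
      have "\<epsilon> * 1 \<le> \<epsilon> * \<phi>" using \<phi> e by (intro mult_left_mono) auto
      moreover have "(real n * \<phi> - real s - \<epsilon>) * \<phi> = real n * (\<phi> * \<phi>) - real s * \<phi> - \<epsilon> * \<phi>"
        by (simp add: algebra_simps)
      ultimately show ?thesis using \<phi>(3) by simp
    qed
    ultimately have "(real n * \<phi> - real s - \<epsilon>) * \<phi> < real m * \<phi>" by linarith
    then show ?thesis using \<phi> by simp
  qed
  show ?case using upper lower by (simp add: m_def \<phi>_def)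
qed

lemma wythoff_seq_1_bounds:
  assumes "1 \<le> n"
  shows "real n * golden_ratio - 1 < real (wythoff_seq 1 n)"
    and "real (wythoff_seq 1 n) < real n * golden_ratio"
  using wythoff_seq_bounds[of 1 n 0] assms by simp_all

lemma wythoff_seq_1_eq_floor:
  assumes "1 \<le> n"
  shows "wythoff_seq 1 n = nat \<lfloor>real n * golden_ratio\<rfloor>"
proof -
  have "\<lfloor>real n * golden_ratio\<rfloor> = int (wythoff_seq 1 n)"
    using wythoff_seq_1_bounds[OF assms] by (intro floor_unique) auto
  then show ?thesis by simp
qed

text \<open>With \<epsilon> = 1 the upper bound for \<open>s = 3\<close> is n \<phi> - 1, exactly
  the lower bound for \<open>s = 1\<close>; the side condition becomes 2 (\<phi> + 1) < 6.\<close>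

lemma wythoff_seq_3_less:
  assumes "3 \<le> n"
  shows "wythoff_seq 3 n < wythoff_seq 1 n"
  using wythoff_seq_bounds[of 3 n 1] wythoff_seq_1_bounds(1)[of n] golden_ratio_bounds assms
  by simp

lemma wythoff_seq_1_values:
  "wythoff_seq 1 1 = 1" "wythoff_seq 1 2 = 3" "wythoff_seq 1 3 = 4" "wythoff_seq 1 4 = 6"
  using wythoff_seq_1_bounds[of 1] wythoff_seq_1_bounds[of 2] wythoff_seq_1_bounds[of 3]
    wythoff_seq_1_bounds[of 4] golden_ratio_bounds by simp_all

section \<open>Positions of Grundy number 1\<close>

text \<open>The pairs (4,4), (1,2), (5,7), (0,3) replace (0,0), (1,2), (3,5), (4,7); both lists use
  the coordinates 0, 1, 2, 3, 4, 5, 7.\<close>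

definition modified_seq :: "nat \<Rightarrow> nat" where
  "modified_seq n =
    (if n = 0 then 4 else if n = 1 then 1 else if n = 2 then 5 else if n = 3 then 0
     else wythoff_seq 1 n)"

lemma modified_seq_simps [simp]:
  "modified_seq 0 = 4" "modified_seq 1 = 1" "modified_seq (Suc 0) = 1" "modified_seq 2 = 5"
  "modified_seq 3 = 0" "4 \<le> n \<Longrightarrow> modified_seq n = wythoff_seq 1 n"
  by (simp_all add: modified_seq_def)

lemma less_4_cases: "n < 4 \<Longrightarrow> n = 0 \<or> n = 1 \<or> n = 2 \<or> n = (3 :: nat)"
  by linarith

text \<open>7 is the larger coordinate of (4,7), hence never a smaller one. With the bound 6 this
  keeps later terms off the coordinates of the first four pairs.\<close>

lemma wythoff_seq_1_ge_4:
  assumes "4 \<le> n"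
  shows "6 \<le> wythoff_seq 1 n" "wythoff_seq 1 n \<noteq> 7"
proof -
  show "6 \<le> wythoff_seq 1 n"
    using wythoff_seq_less[of 1 4 n] wythoff_seq_1_values(4) assms by (cases "n = 4") auto
  show "wythoff_seq 1 n \<noteq> 7"
    using wythoff_seq_neq_add[of 1 n 3] wythoff_seq_1_values(3) assms by simp
qed

lemma modified_seq_small_cases:
  assumes "n < 4"
  shows "n = 0 \<and> modified_seq n = 4 \<or> n = 1 \<and> modified_seq n = 1 \<or>
    n = 2 \<and> modified_seq n = 5 \<or> n = 3 \<and> modified_seq n = 0"
  using less_4_cases[OF assms] by auto

lemma modified_seq_large:
  assumes "4 \<le> n"
  shows "modified_seq n = wythoff_seq 1 n \<and> 6 \<le> modified_seq n \<and> modified_seq n \<noteq> 7"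
  using wythoff_seq_1_ge_4[OF assms] assms by simp

lemma modified_seq_cover:
  obtains n where "x = modified_seq n" | n where "x = modified_seq n + n"
proof (cases "x \<in> {0, 1, 2, 3, 4, 5, 7}")
  case True
  have "x = modified_seq 3 \<or> x = modified_seq 1 \<or> x = modified_seq 1 + 1 \<or>
      x = modified_seq 3 + 3 \<or> x = modified_seq 0 \<or> x = modified_seq 2 \<or> x = modified_seq 2 + 2"
    using True by auto
  then show ?thesis using that by blast
next
  case False
  \<comment> \<open>Away from the coordinates of the first four pairs, \<open>x\<close> has an index
    at which the modified and the original sequence agree.\<close>
  have "4 \<le> n" if "1 \<le> n" "x = wythoff_seq 1 n \<or> x = wythoff_seq 1 n + n" for n
  proof (rule ccontr)
    assume "\<not> 4 \<le> n"
    then have "n = 1 \<or> n = 2 \<or> n = 3" using that(1) by linarith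
    then show False using False that(2) wythoff_seq_1_values by auto
  qed
  then have *: "modified_seq n = wythoff_seq 1 n"
    if "1 \<le> n" "x = wythoff_seq 1 n \<or> x = wythoff_seq 1 n + n" for n
    using that by simp
  have "1 \<le> x" using False by auto
  then show ?thesis
  proof (cases rule: wythoff_seq_cover)
    case (1 n)
    then show ?thesis using * that(1) by metis
  next
    case (2 n)
    then show ?thesis using * that(2) by metis
  qed
qed

lemma inj_modified_seq: "inj modified_seq"
proof (rule injI)
  fix i j assume eq: "modified_seq i = modified_seq j"
  show "i = j"
  proof (cases "4 \<le> i \<and> 4 \<le> j")
    case True
    then show ?thesis using eq inj_onD[OF inj_on_wythoff_seq[of 1], of i j] by simp
  next
    case False
    then show ?thesis
      using eq modified_seq_small_cases[of i] modified_seq_small_cases[of j]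
        modified_seq_large[of i] modified_seq_large[of j] by linarith
  qed
qed

lemma inj_modified_seq_add: "inj (\<lambda>n. modified_seq n + n)"
proof (rule injI)
  fix i j assume eq: "modified_seq i + i = modified_seq j + j"
  show "i = j"
  proof (cases "4 \<le> i \<and> 4 \<le> j")
    case True
    then show ?thesis using eq inj_onD[OF inj_on_wythoff_seq_add[of 1], of i j] by simp
  next
    case False
    then show ?thesis
      using eq modified_seq_small_cases[of i] modified_seq_small_cases[of j]
        modified_seq_large[of i] modified_seq_large[of j] by linarith
  qed
qed

text \<open>Below index 4 the smaller coordinates 4, 1, 5, 0 and the larger ones 4, 2, 7, 3 share
  only 4, both times at index 0. From index 4 on the smaller ones are at least 6 and avoid 7, the
  larger ones are at least 10.\<close>

lemma modified_seq_eq_add: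
  assumes eq: "modified_seq i = modified_seq j + j"
  shows "i = j"
proof (cases "4 \<le> i \<and> 4 \<le> j")
  case True
  then show ?thesis using eq wythoff_seq_neq_add[of 1 i j] by simp
next
  case False
  then show ?thesis
    using eq modified_seq_small_cases[of i] modified_seq_small_cases[of j]
      modified_seq_large[of i] modified_seq_large[of j] by linarith
qed

text \<open>The first four terms 4, 1, 5, 0 are not monotone, but all lie below 6, the least later
  term.\<close>

lemma modified_seq_less:
  assumes "4 \<le> n" "d < n"
  shows "modified_seq d < modified_seq n"
  using assms wythoff_seq_less[of 1 d n] modified_seq_small_cases[of d] modified_seq_large[of n]
    modified_seq_large[of d]
  by (cases "4 \<le> d") auto

lemma variant_terminals_eq: "variant_terminals = corner 3"
  by (auto simp: variant_terminals_def corner_def)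

section \<open>Moves out of and into the modified pairs\<close>

lemma modified_pair_has_zero_option:
  assumes "p \<in> pairs modified_seq UNIV"
  shows "\<exists>q \<in> options (corner 3) p. grundy (corner 3) q = 0"
proof -
  let ?Z = "corner 3 \<union> pairs (wythoff_seq 3) {3..}"
  let ?c = modified_seq
  obtain x y where xy: "p = (x, y)" by fastforce
  from assms obtain n where n: "x = ?c n \<and> y = ?c n + n \<or> x = ?c n + n \<and> y = ?c n"
    by (auto simp: pairs_def xy)
  have "\<exists>u v. (u, v) \<in> queen_moves (?c n, ?c n + n) \<and> (u, v) \<in> ?Z"
  proof (cases "4 \<le> n")
    case True
    let ?u = "wythoff_seq 3 n"
    \<comment> \<open>On the same diagonal, the variant's pair of difference \<open>n\<close> lies
      strictly below the Wythoff pair.\<close>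
    have "(?u, ?u + n) \<in> queen_moves (?c n, ?c n + n)"
      using wythoff_seq_3_less[of n] True by (simp add: queen_moves_iff)
    moreover have "(?u, ?u + n) \<in> ?Z" using True pairs_memI(1)[of n "{3..}"] by simp
    ultimately show ?thesis by blast
  next
    case False
    \<comment> \<open>The four exceptional pairs move directly into the corner.\<close>
    have "(0, 0) \<in> queen_moves (4, 4)" "(1, 1) \<in> queen_moves (1, 2)"
      "(0, 2) \<in> queen_moves (5, 7)" "(0, 0) \<in> queen_moves (0, 3)"
      by (simp_all add: queen_moves_iff)
    moreover have "(0, 0) \<in> ?Z" "(1, 1) \<in> ?Z" "(0, 2) \<in> ?Z" by (simp_all add: corner_def)
    moreover have "(?c n, ?c n + n) \<in> {(4, 4), (1, 2), (5, 7), (0, 3)}"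
      using less_4_cases[of n] False by auto
    ultimately show ?thesis by (metis empty_iff insert_iff)
  qed
  then obtain u v where uv: "(u, v) \<in> queen_moves (?c n, ?c n + n)" "(u, v) \<in> ?Z" by blast
  have "(v, u) \<in> ?Z" using uv(2) by (auto simp: corner_def swap_mem_pairs_iff)
  moreover have "(v, u) \<in> queen_moves (?c n + n, ?c n)"
    using uv(1) by (simp add: swap_mem_queen_moves_iff)
  ultimately obtain q where q: "q \<in> queen_moves p" "q \<in> ?Z"
    using uv n xy by blast
  have "p \<notin> corner 3"
    using n modified_seq_small_cases[of n] modified_seq_large[of n]
    by (cases "4 \<le> n") (auto simp: corner_def xy)
  then show ?thesis
    using q by (intro bexI[of _ q]) (simp_all add: options_def grundy_corner_eq_0_iff)
qed

lemma exists_move_to_modified_pair: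
  assumes "p \<notin> pairs modified_seq UNIV" "p \<notin> corner 3"
  shows "\<exists>q \<in> options (corner 3) p. q \<in> pairs modified_seq UNIV"
proof -
  let ?c = modified_seq
  let ?S = "pairs ?c UNIV"
  have *: "\<exists>u v. (u, v) \<in> queen_moves (x, y) \<and> (u, v) \<in> ?S"
    if le: "x \<le> y" and nS: "(x, y) \<notin> ?S" and nT: "(x, y) \<notin> corner 3" for x y
  proof (cases x rule: modified_seq_cover)
    case (1 n)
    have "y \<noteq> x + n" using nS 1 by (auto simp: pairs_def)
    then consider "x + n < y" | "y < x + n" by linarith
    then show ?thesis
    proof cases
      case 1
      then have "(x, x + n) \<in> queen_moves (x, y) \<and> (x, x + n) \<in> ?S"
        using \<open>x = ?c n\<close> by (auto simp: queen_moves_iff pairs_def)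
      then show ?thesis by blast
    next
      case 2
      let ?d = "y - x"
      have "?c ?d < x"
      proof (cases "4 \<le> n")
        case True
        then show ?thesis using modified_seq_less[of n ?d] 2 \<open>x = ?c n\<close> by auto
      next
        case False
        \<comment> \<open>For \<open>n = 0\<close> no such \<open>y\<close> exists, and
          \<open>n = 1\<close> or \<open>n = 3\<close> would put \<open>(x, y)\<close> into the
          corner. From \<open>x = 5\<close> the differences 0 and 1 lead down to the terms 4 and
          1.\<close>
        then have "x = 5 \<and> (y = 5 \<or> y = 6)"
          using modified_seq_small_cases[of n] 2 \<open>x = ?c n\<close> le nT by (auto simp: corner_def)
        then show ?thesis by auto
      qed
      then have "(?c ?d, ?c ?d + ?d) \<in> queen_moves (x, y)"
        using le by (auto simp: queen_moves_iff)
      then show ?thesis using pairs_memI(1)[of ?d UNIV ?c] by blast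
    qed
  next
    case (2 n)
    \<comment> \<open>At index 0 both coordinates are 4, so the drop to \<open>?c n\<close> is a
      genuine move only because (4,4) lies in \<open>?S\<close> and hence \<open>y\<close> is not
      4.\<close>
    have "n = 0 \<Longrightarrow> y \<noteq> ?c n" using nS 2 pairs_memI(1)[of 0 UNIV ?c] by auto
    then have "(x, ?c n) \<in> queen_moves (x, y)"
      using 2 le by (cases "n = 0") (auto simp: queen_moves_iff)
    then show ?thesis using 2 pairs_memI(2)[of n UNIV ?c] by blast
  qed
  obtain x y where xy: "p = (x, y)" by fastforce
  have "\<exists>u v. (u, v) \<in> queen_moves (x, y) \<and> (u, v) \<in> ?S"
  proof (cases "x \<le> y")
    case True
    then show ?thesis using * assms xy by simp
  next
    case False
    have "(y, x) \<notin> ?S" "(y, x) \<notin> corner 3"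
      using assms xy by (auto simp: swap_mem_pairs_iff corner_def)
    then show ?thesis
      using *[of y x] False swap_mem_queen_moves_iff swap_mem_pairs_iff by (metis nat_le_linear)
  qed
  then show ?thesis using assms xy by (auto simp: options_def)
qed

lemma grundy_variant_eq_1_iff:
  "grundy variant_terminals p = 1 \<longleftrightarrow> p \<in> pairs modified_seq UNIV"
  unfolding variant_terminals_eq
proof (rule grundy_eq_1_iff_mem)
  fix p q assume p: "p \<in> pairs modified_seq UNIV" and "q \<in> options (corner 3) p"
  then have q: "q \<in> queen_moves p" by (simp add: options_def split: if_splits)
  show "q \<notin> pairs modified_seq UNIV"
    using inj_modified_seq inj_modified_seq_add modified_seq_eq_add p q
    by (rule pairs_independent)
qed (use modified_pair_has_zero_option exists_move_to_modified_pair in blast)+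

section \<open>Comparison with Wythoff's game\<close>

text \<open>The first four pairs of either family have coordinates at most 7, whence the bound 8;
  from index 4 on the two sequences agree.\<close>

lemma pairs_modified_seq_iff:
  assumes "8 \<le> x \<or> 8 \<le> y"
  shows "(x, y) \<in> pairs modified_seq UNIV \<longleftrightarrow> (x, y) \<in> pairs (wythoff_seq 1) {1..}"
proof -
  have "(x, y) \<in> pairs modified_seq UNIV \<longleftrightarrow> (x, y) \<in> pairs modified_seq {4..}"
  proof
    assume "(x, y) \<in> pairs modified_seq UNIV"
    then obtain n where n: "x = modified_seq n \<and> y = modified_seq n + n \<or>
        x = modified_seq n + n \<and> y = modified_seq n"
      by (auto simp: pairs_def)
    have "4 \<le> n" using n assms modified_seq_small_cases[of n] by linarith
    then show "(x, y) \<in> pairs modified_seq {4..}" using n pairs_memI[of n "{4..}" modified_seq] by (metis atLeast_iff)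
  qed (auto simp: pairs_def)
  also have "\<dots> \<longleftrightarrow> (x, y) \<in> pairs (wythoff_seq 1) {4..}"
    using pairs_cong[of "{4..}" modified_seq "wythoff_seq 1"] by simp
  also have "\<dots> \<longleftrightarrow> (x, y) \<in> pairs (wythoff_seq 1) {1..}"
  proof
    assume "(x, y) \<in> pairs (wythoff_seq 1) {1..}"
    then obtain n where n: "1 \<le> n" "x = wythoff_seq 1 n \<and> y = wythoff_seq 1 n + n \<or>
        x = wythoff_seq 1 n + n \<and> y = wythoff_seq 1 n"
      by (auto simp: pairs_def)
    have "4 \<le> n"
    proof (rule ccontr)
      assume "\<not> 4 \<le> n"
      then have "n = 1 \<or> n = 2 \<or> n = 3" using n(1) by linarith
      then show False using n(2) assms wythoff_seq_1_values by auto
    qed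
    then show "(x, y) \<in> pairs (wythoff_seq 1) {4..}" using n(2) by (auto simp: pairs_def)
  qed (auto simp: pairs_def)
  finally show ?thesis .
qed

lemma wythoff_P_position_iff:
  "wythoff_P_position p \<longleftrightarrow> p = (0, 0) \<or> p \<in> pairs (wythoff_seq 1) {1..}"
proof -
  have c: "corner 1 = {(0, 0)}" by (auto simp: corner_def)
  show ?thesis
    unfolding wythoff_P_position_def using outcome_grundy[of "{(0, 0)}" p]
      grundy_corner_eq_0_iff[of 1 p] unfolding c by simp
qed

lemma pairs_floor_eq:
  "{(nat \<lfloor>real n * golden_ratio\<rfloor>, nat \<lfloor>real n * (golden_ratio + 1)\<rfloor>) |n :: nat. True} \<union>
    {(nat \<lfloor>real n * (golden_ratio + 1)\<rfloor>, nat \<lfloor>real n * golden_ratio\<rfloor>) |n :: nat. True} =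
    {(0, 0)} \<union> pairs (wythoff_seq 1) {1..}"
proof -
  define f where "f n = nat \<lfloor>real n * golden_ratio\<rfloor>" for n :: nat
  have f2: "nat \<lfloor>real n * (golden_ratio + 1)\<rfloor> = f n + n" for n :: nat
  proof -
    have "\<lfloor>real n * (golden_ratio + 1)\<rfloor> = \<lfloor>real n * golden_ratio\<rfloor> + int n"
      by (simp add: algebra_simps flip: floor_add_int)
    moreover have "0 \<le> real n * golden_ratio" using golden_ratio_bounds by simp
    ultimately show ?thesis by (simp add: f_def nat_add_distrib)
  qed
  have f0: "f 0 = 0" by (simp add: f_def)
  have f: "f n = wythoff_seq 1 n" if "1 \<le> n" for n
    using wythoff_seq_1_eq_floor[OF that] by (simp add: f_def)
  \<comment> \<open>Index 0 contributes (0,0) and is split off, because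
    \<open>wythoff_seq 1 0\<close> is 1 and not 0.\<close>
  have "pairs f UNIV = pairs f (insert 0 {1..})"
    by (rule arg_cong[where f = "pairs f"]) auto
  also have "\<dots> = {(0, 0)} \<union> pairs f {1..}"
    using f0 by (auto simp: pairs_def)
  also have "pairs f {1..} = pairs (wythoff_seq 1) {1..}"
    using f by (intro pairs_cong) simp
  finally show ?thesis
    unfolding f2 f_def[symmetric] by (simp add: pairs_def)
qed

theorem theorem6p9:
  fixes x y :: nat
  assumes "x \<ge> 8 \<or> y \<ge> 8"
  shows "(grundy variant_terminals (x, y) = 1 \<longleftrightarrow> wythoff_P_position (x, y)) \<and>
    (grundy variant_terminals (x, y) = 1 \<longleftrightarrow>
      (x, y) \<in>
        {(nat \<lfloor>real n * golden_ratio\<rfloor>, nat \<lfloor>real n * (golden_ratio + 1)\<rfloor>) |n :: nat. True} \<union>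
        {(nat \<lfloor>real n * (golden_ratio + 1)\<rfloor>, nat \<lfloor>real n * golden_ratio\<rfloor>) |n :: nat. True})"
  unfolding pairs_floor_eq grundy_variant_eq_1_iff wythoff_P_position_iff
    pairs_modified_seq_iff[OF assms] using assms by auto

end
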